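(* Consider a linear quantum system with $n$ oscillators, $m$ input channels, scattering matrix $S=I$, coupling operator $\mathbf{L}=C_-\mathbf{a}+C_+\mathbf{a}^\#$ and Hamiltonian matrix $\Omega=\Delta(\Omega_-,\Omega_+)$ (all notation as in the context), and assume that $[\mathbf{L},\mathbf{H}]=0$. 1. If $C_-=-C_+$ ($\mathbf{p}$-coupling) and $\Omega_-=-\Omega_+$, then $\mathbf{p}$ is a QND variable provided the subsystem $(\mathrm{Im}(\Omega_-),0,-\mathrm{Im}(C_-))$ or the subsystem $(\mathrm{Im}(\Omega_-),0,\mathrm{Re}(C_-))$ is observable. Moreover, BAE measurements are realized from $\mathbf{p}_{\rm in}$ to $\mathbf{q}_{\rm out}$ and from $\mathbf{q}_{\rm in}$ to $\mathbf{p}_{\rm out}$, i.e. $\mathbb{G}_{\mathbf{p}_{\rm in}\to\mathbf{q}_{\rm out}}[s]\equiv0$ and $\mathbb{G}_{\mathbf{q}_{\rm in}\to\mathbf{p}_{\rm out}}[s]\equiv0$. 2. If $C_-=C_+$ ($\mathbf{q}$-coupling) and $\Omega_-=\Omega_+$, then $\mathbf{q}$ is a QND variable provided the subsystem $(\mathrm{Im}(\Omega_-),0,\mathrm{Im}(C_-))$ or the subsystem $(\mathrm{Im}(\Omega_-),0,\mathrm{Re}(C_-))$ is observable. Moreover, BAE measurements are realized from $\mathbf{p}_{\rm in}$ to $\mathbf{q}_{\rm out}$ and from $\mathbf{q}_{\rm in}$ to $\mathbf{p}_{\rm out}$.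
   Context: $\imath=\sqrt{-1}$; $X^\#$ is the entrywise complex conjugate (adjoint, for operator entries), $X^\dagger=(X^\#)^\top$; $\Delta(U,V)=\begin{bmatrix} U & V \\ V^\# & U^\# \end{bmatrix}$; $J_k=\mathrm{diag}(I_k,-I_k)$; for $X\in\mathbf{C}^{2k\times 2r}$, $X^\flat=J_rX^\dagger J_k$; $V_k=\frac1{\sqrt2}\begin{bmatrix} I_k & I_k \\ -\imath I_k & \imath I_k \end{bmatrix}$. A linear quantum system is specified by: a unitary $S\in\mathbf{C}^{m\times m}$; matrices $C_-,C_+\in\mathbf{C}^{m\times n}$, with $\mathcal{C}=\Delta(C_-,C_+)$; and $\Omega_-,\Omega_+\in\mathbf{C}^{n\times n}$ such that $\Omega=\Delta(\Omega_-,\Omega_+)$ is Hermitian (equivalently $\Omega_-$ Hermitian, $\Omega_+$ symmetric). The coupling operator is $\mathbf{L}=C_-\mathbf{a}+C_+\mathbf{a}^\#$ and the Hamiltonian is $\mathbf{H}=\frac12\begin{bmatrix} \mathbf{a} \\ \mathbf{a}^\# \end{bmatrix}^\dagger\Omega\begin{bmatrix} \mathbf{a} \\ \mathbf{a}^\# \end{bmatrix}$, where $\mathbf{a}=(\mathbf{a}_1,\dots,\mathbf{a}_n)^\top$ are annihilation operators with $[\mathbf{a}_j,\mathbf{a}_k^*]=\delta_{jk}$, $[\mathbf{a}_j,\mathbf{a}_k]=0$. $[\mathbf{L},\mathbf{H}]=0$ means that every component of $\mathbf{L}$ commutes with $\mathbf{H}$ (computed with these commutation relations). In real quadrature form the system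 is $$\dot{\mathbf{x}}=\mathbb{A}\mathbf{x}+\mathbb{B}\mathbf{u},\qquad \mathbf{y}=\mathbb{C}\mathbf{x}+\mathbb{D}\mathbf{u},\qquad \mathbf{x}=\begin{bmatrix} \mathbf{q} \\ \mathbf{p} \end{bmatrix},\ \mathbf{u}=\begin{bmatrix} \mathbf{q}_{\rm in} \\ \mathbf{p}_{\rm in} \end{bmatrix},\ \mathbf{y}=\begin{bmatrix} \mathbf{q}_{\rm out} \\ \mathbf{p}_{\rm out} \end{bmatrix},$$ where $\mathbb{D}=V_m\Delta(S,0)V_m^\dagger$, $\mathbb{C}=V_m\mathcal{C}V_n^\dagger$, $\mathbb{B}=-V_n\mathcal{C}^\flat\Delta(S,0)V_m^\dagger$, $\mathbb{A}=V_n\left(-\imath J_n\Omega-\frac12\mathcal{C}^\flat\mathcal{C}\right)V_n^\dagger$ are real matrices. The transfer matrix is $\mathbb{G}[s]=\mathbb{D}+\mathbb{C}(sI-\mathbb{A})^{-1}\mathbb{B}$, partitioned into four $m\times m$ blocks conformably with $\mathbf{u}$ and $\mathbf{y}$; e.g. $\mathbb{G}_{\mathbf{p}_{\rm in}\to\mathbf{q}_{\rm out}}$ is the $(1,2)$ block. A BAE measurement is realized from an input quadrature to an output quadrature when the corresponding transfer block vanishes identically. A vector of system variables $\mathbf{z}=T\mathbf{x}$ ($T$ a real matrix) is a QND variable if it evolves autonomously and independently of the inputs ($T\mathbb{A}=FT$ for some matrix $F$, and $T\mathbb{B}=0$; in particular it is uncontrollable) and is observable from the output (the rows of $T$ lie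 in the row space of the observability matrix of $(\mathbb{A},\mathbb{C})$). A subsystem $(A,0,C)$ is observable if the pair $(A,C)$ is observable in the usual sense. *)

theory Defs
  imports "HOL-Analysis.Analysis"
begin

section \<open>Matrices in doubled-up and quadrature form\<close>

text \<open>Doubled-up vectors (annihilation and creation parts, or position and momentum parts) are
  indexed by a disjoint sum: \<open>Inl\<close> is the first half, \<open>Inr\<close> the second half.\<close>

definition block_mat ::
  "'a^'c^'r \<Rightarrow> 'a^'d^'r \<Rightarrow> 'a^'c^'s \<Rightarrow> 'a^'d^'s \<Rightarrow> 'a^('c::finite + 'd::finite)^('r::finite + 's::finite)" where
  "block_mat P Q R S = (\<chi> i j. case i of
      Inl k \<Rightarrow> (case j of Inl l \<Rightarrow> P $ k $ l | Inr l \<Rightarrow> Q $ k $ l)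
    | Inr k \<Rightarrow> (case j of Inl l \<Rightarrow> R $ k $ l | Inr l \<Rightarrow> S $ k $ l))"

definition block12 :: "'a^('c::finite + 'd::finite)^('r::finite + 's::finite) \<Rightarrow> 'a^'d^'r" where
  "block12 X = (\<chi> i j. X $ Inl i $ Inr j)"

definition block21 :: "'a^('c::finite + 'd::finite)^('r::finite + 's::finite) \<Rightarrow> 'a^'c^'s" where
  "block21 X = (\<chi> i j. X $ Inr i $ Inl j)"

abbreviation conj_mat :: "complex^'c^'r \<Rightarrow> complex^'c^'r" where
  "conj_mat \<equiv> map_matrix cnj"

abbreviation Re_mat :: "complex^'c^'r \<Rightarrow> real^'c^'r" where
  "Re_mat \<equiv> map_matrix Re"

abbreviation Im_mat :: "complex^'c^'r \<Rightarrow> real^'c^'r" where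
  "Im_mat \<equiv> map_matrix Im"

abbreviation complex_mat :: "real^'c^'r \<Rightarrow> complex^'c^'r" where
  "complex_mat \<equiv> map_matrix complex_of_real"

definition adj :: "complex^'c^'r \<Rightarrow> complex^'r^'c" where
  "adj X = transpose (conj_mat X)"

definition Delta ::
  "complex^'c^'r \<Rightarrow> complex^'c^'r \<Rightarrow> complex^('c::finite + 'c)^('r::finite + 'r)" where
  "Delta U V = block_mat U V (conj_mat V) (conj_mat U)"

definition J_mat :: "complex^('k::finite + 'k)^('k + 'k)" where
  "J_mat = block_mat (mat 1) 0 0 (- mat 1)"

definition flat ::
  "complex^('r::finite + 'r)^('k::finite + 'k) \<Rightarrow> complex^('k + 'k)^('r + 'r)" where
  "flat X = J_mat ** adj X ** J_mat"

definition V_mat :: "complex^('k::finite + 'k)^('k + 'k)" where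
  "V_mat = (1 / sqrt 2) *\<^sub>R block_mat (mat 1) (mat 1) (- mat \<i>) (mat \<i>)"


section \<open>Linear quantum systems\<close>

text \<open>\<open>'n\<close> indexes the oscillators and \<open>'m\<close> the input channels.\<close>

record ('n, 'm) lqs =
  scattering :: "complex^'m::finite^'m"
  Cminus :: "complex^'n::finite^'m"
  Cplus :: "complex^'n^'m"
  Omegaminus :: "complex^'n^'n"
  Omegaplus :: "complex^'n^'n"

definition coupling_mat :: "('n::finite, 'm::finite) lqs \<Rightarrow> complex^('n + 'n)^('m + 'm)" where
  "coupling_mat Q = Delta (Cminus Q) (Cplus Q)"

definition Omega_mat :: "('n::finite, 'm::finite) lqs \<Rightarrow> complex^('n + 'n)^('n + 'n)" where
  "Omega_mat Q = Delta (Omegaminus Q) (Omegaplus Q)"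

definition linear_quantum_system :: "('n::finite, 'm::finite) lqs \<Rightarrow> bool" where
  "linear_quantum_system Q \<longleftrightarrow>
     adj (scattering Q) ** scattering Q = mat 1 \<and>
     scattering Q ** adj (scattering Q) = mat 1 \<and>
     adj (Omega_mat Q) = Omega_mat Q"


subsection \<open>Real quadrature form\<close>

text \<open>The defining expressions are complex matrices with vanishing imaginary part (see the lemmas
  \<open>complex_quad_A\<close> to \<open>complex_quad_D\<close> below), so applying \<^term>\<open>Re_mat\<close> loses no information.\<close>

definition quad_D :: "('n::finite, 'm::finite) lqs \<Rightarrow> real^('m + 'm)^('m + 'm)" where
  "quad_D Q = Re_mat (V_mat ** Delta (scattering Q) 0 ** adj V_mat)"

definition quad_C :: "('n::finite, 'm::finite) lqs \<Rightarrow> real^('n + 'n)^('m + 'm)" where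
  "quad_C Q = Re_mat (V_mat ** coupling_mat Q ** adj V_mat)"

definition quad_B :: "('n::finite, 'm::finite) lqs \<Rightarrow> real^('m + 'm)^('n + 'n)" where
  "quad_B Q = Re_mat (- (V_mat ** flat (coupling_mat Q) ** Delta (scattering Q) 0 ** adj V_mat))"

definition quad_A :: "('n::finite, 'm::finite) lqs \<Rightarrow> real^('n + 'n)^('n + 'n)" where
  "quad_A Q = Re_mat (V_mat
     ** (mat (- \<i>) ** J_mat ** Omega_mat Q - (1 / 2) *\<^sub>R (flat (coupling_mat Q) ** coupling_mat Q))
     ** adj V_mat)"

definition swap :: "'k + 'k \<Rightarrow> 'k + 'k" where
  "swap i = (case i of Inl k \<Rightarrow> Inr k | Inr k \<Rightarrow> Inl k)"

lemma swap_simps [simp]: "swap (Inl k) = Inr k" "swap (Inr k) = Inl k" "swap (swap i) = i"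
  by (simp_all add: swap_def split: sum.split)

lemma sum_swap: "(\<Sum>k\<in>UNIV. f (swap k)) = (\<Sum>k\<in>UNIV. f k)"
  by (rule sum.reindex_bij_witness [of _ swap swap]) auto

definition doubled :: "complex^('c::finite + 'c)^('r::finite + 'r) \<Rightarrow> bool" where
  "doubled X \<longleftrightarrow> (\<forall>i j. cnj (X $ i $ j) = X $ swap i $ swap j)"

lemma doubled_Delta: "doubled (Delta U V)"
  by (auto simp: doubled_def Delta_def block_mat_def split: sum.split)

lemma doubled_mult: "doubled X \<Longrightarrow> doubled Y \<Longrightarrow> doubled (X ** Y)"
  using sum_swap [of "\<lambda>k. X $ swap i $ k * Y $ k $ swap j" for i j]
  by (simp add: doubled_def matrix_matrix_mult_def)

lemma doubled_diff: "doubled X \<Longrightarrow> doubled Y \<Longrightarrow> doubled (X - Y)"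
  by (simp add: doubled_def)

lemma doubled_scaleR: "doubled X \<Longrightarrow> doubled (r *\<^sub>R X)"
  by (simp add: doubled_def)

lemma mat_mult_nth:
  "(mat c ** X) $ i $ j = c * X $ i $ j" for X :: "'a::comm_semiring_1^'c^'r"
  by (simp add: mat_def matrix_matrix_mult_def if_distrib [of "\<lambda>x. x * _"] cong: if_cong)

lemma doubled_iJ: "doubled (mat (- \<i>) ** J_mat)"
  unfolding doubled_def mat_mult_nth
  by (auto simp: J_mat_def block_mat_def mat_def split: sum.split)

lemma flat_eq: "flat X = (-1) *\<^sub>R (mat (- \<i>) ** J_mat ** adj X ** (mat (- \<i>) ** J_mat))"
proof -
  have *: "Y ** (mat c ** Z) = mat c ** (Y ** Z)"
    for c :: complex and Y :: "complex^'x^'y" and Z :: "complex^'z^'x"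
    by (simp add: vec_eq_iff mat_mult_nth matrix_matrix_mult_def [of Y] sum_distrib_left
        mult.left_commute)
  have "mat (- \<i>) ** J_mat ** adj X ** (mat (- \<i>) ** J_mat) = mat (- \<i>) ** (mat (- \<i>) ** flat X)"
    unfolding flat_def * [of "mat (- \<i>) ** J_mat ** adj X"] by (simp only: matrix_mul_assoc)
  also have "\<dots> = (-1) *\<^sub>R flat X"
    by (simp add: vec_eq_iff mat_mult_nth flip: mult.assoc)
  finally show ?thesis
    by simp
qed

lemma doubled_flat:
  assumes "doubled X"
  shows "doubled (flat X)"
proof -
  have "doubled (adj X)"
    using assms by (auto simp: doubled_def adj_def transpose_def)
  then show ?thesis
    unfolding flat_eq by (intro doubled_scaleR doubled_mult doubled_iJ)
qed

lemma cnj_V_mat: "cnj (V_mat $ i $ j) = V_mat $ i $ swap j"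
  by (cases i; cases j) (auto simp: V_mat_def block_mat_def mat_def)

lemma doubled_real:
  assumes "doubled X"
  shows "complex_mat (Re_mat (V_mat ** X ** adj V_mat)) = V_mat ** X ** adj V_mat"
proof -
  have 1: "cnj ((V_mat ** X) $ i $ j) = (V_mat ** X) $ i $ swap j" for i j
    using assms sum_swap [of "\<lambda>k. V_mat $ i $ k * X $ k $ swap j"]
    by (simp add: matrix_matrix_mult_def doubled_def cnj_V_mat)
  have 2: "cnj (adj V_mat $ i $ j) = adj V_mat $ swap i $ j" for i and j :: "'k::finite + 'k"
    by (simp add: adj_def transpose_def cnj_V_mat)
  have "cnj ((V_mat ** X ** adj V_mat) $ i $ j) = (V_mat ** X ** adj V_mat) $ i $ j" for i j
    using sum_swap [of "\<lambda>k. (V_mat ** X) $ i $ k * adj V_mat $ k $ j"]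
    by (simp add: matrix_matrix_mult_def [of "V_mat ** X"] 1 2)
  then show ?thesis
    by (simp add: vec_eq_iff complex_eq_iff eq_neg_iff_add_eq_0)
qed

lemma complex_Re_uminus: "complex_mat (Re_mat (- X)) = - complex_mat (Re_mat X)"
  by (simp add: vec_eq_iff)

lemma complex_quad_D: "complex_mat (quad_D Q) = V_mat ** Delta (scattering Q) 0 ** adj V_mat"
  unfolding quad_D_def by (intro doubled_real doubled_Delta)

lemma complex_quad_C: "complex_mat (quad_C Q) = V_mat ** coupling_mat Q ** adj V_mat"
  unfolding quad_C_def coupling_mat_def by (intro doubled_real doubled_Delta)

lemma complex_quad_B:
  "complex_mat (quad_B Q) = - (V_mat ** flat (coupling_mat Q) ** Delta (scattering Q) 0 ** adj V_mat)"
  unfolding quad_B_def coupling_mat_def complex_Re_uminus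
  by (simp only: matrix_mul_assoc
      doubled_real [OF doubled_mult [OF doubled_flat [OF doubled_Delta] doubled_Delta],
        unfolded matrix_mul_assoc])

lemma complex_quad_A:
  "complex_mat (quad_A Q) = V_mat
     ** (mat (- \<i>) ** J_mat ** Omega_mat Q - (1 / 2) *\<^sub>R (flat (coupling_mat Q) ** coupling_mat Q))
     ** adj V_mat"
  unfolding quad_A_def coupling_mat_def Omega_mat_def
  by (intro doubled_real doubled_diff doubled_scaleR doubled_mult doubled_iJ doubled_flat doubled_Delta)


subsection \<open>Transfer matrix\<close>

definition transfer ::
  "('n::finite, 'm::finite) lqs \<Rightarrow> complex \<Rightarrow> complex^('m + 'm)^('m + 'm)" where
  "transfer Q s = complex_mat (quad_D Q) +
     complex_mat (quad_C Q) ** matrix_inv (mat s - complex_mat (quad_A Q)) ** complex_mat (quad_B Q)"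

text \<open>Blocks of the transfer matrix: columns belong to the input \<open>(q_in, p_in)\<close>, rows to the output
  \<open>(q_out, p_out)\<close>.\<close>

definition transfer_pin_qout :: "('n::finite, 'm::finite) lqs \<Rightarrow> complex \<Rightarrow> complex^'m^'m" where
  "transfer_pin_qout Q s = block12 (transfer Q s)"

definition transfer_qin_pout :: "('n::finite, 'm::finite) lqs \<Rightarrow> complex \<Rightarrow> complex^'m^'m" where
  "transfer_qin_pout Q s = block21 (transfer Q s)"

text \<open>The transfer matrix is a rational function of \<open>s\<close>, meaningful exactly where \<open>s I - A\<close> is
  invertible; elsewhere \<^const>\<open>matrix_inv\<close> is unspecified.\<close>

definition vanishes_identically ::
  "('n::finite, 'm::finite) lqs \<Rightarrow> (complex \<Rightarrow> complex^'c^'r) \<Rightarrow> bool" where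
  "vanishes_identically Q g \<longleftrightarrow> (\<forall>s. invertible (mat s - complex_mat (quad_A Q)) \<longrightarrow> g s = 0)"

definition BAE_pin_qout :: "('n::finite, 'm::finite) lqs \<Rightarrow> bool" where
  "BAE_pin_qout Q \<longleftrightarrow> vanishes_identically Q (transfer_pin_qout Q)"

definition BAE_qin_pout :: "('n::finite, 'm::finite) lqs \<Rightarrow> bool" where
  "BAE_qin_pout Q \<longleftrightarrow> vanishes_identically Q (transfer_qin_pout Q)"


subsection \<open>Observability and QND variables\<close>

text \<open>The product \<open>*\<close> (hence \<open>^\<close>) on the vector type is componentwise, so matrix powers are
  defined here.\<close>

definition mat_pow :: "real^'x^'x \<Rightarrow> nat \<Rightarrow> real^'x^'x" where
  "mat_pow A k = (((**) A) ^^ k) (mat 1)"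

text \<open>The rows of the observability matrix with block rows \<open>C, C A, \<dots>, C A\<^sup>N\<^sup>-\<^sup>1\<close>, where \<open>N\<close> is the
  state dimension; the rank of that matrix is the dimension of their span.\<close>

definition observability_rows :: "real^'x^'x \<Rightarrow> real^'x^'y \<Rightarrow> (real^'x) set" where
  "observability_rows A C = (\<Union>k<CARD('x). rows (C ** mat_pow A k))"

definition observable :: "real^'x^'x \<Rightarrow> real^'x^'y \<Rightarrow> bool" where
  "observable A C \<longleftrightarrow> dim (observability_rows A C) = CARD('x)"

definition QND_variable :: "('n::finite, 'm::finite) lqs \<Rightarrow> real^('n + 'n)^'z \<Rightarrow> bool" where
  "QND_variable Q T \<longleftrightarrow>
     (\<exists>F :: real^'z^'z. T ** quad_A Q = F ** T) \<and>
     T ** quad_B Q = 0 \<and>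
     rows T \<subseteq> span (observability_rows (quad_A Q) (quad_C Q))"

text \<open>The matrices \<open>T\<close> with \<open>q = T x\<close> and \<open>p = T x\<close>.\<close>

definition q_select :: "real^('n::finite + 'n)^'n" where
  "q_select = (\<chi> i j. if j = Inl i then 1 else 0)"

definition p_select :: "real^('n::finite + 'n)^'n" where
  "p_select = (\<chi> i j. if j = Inr i then 1 else 0)"


section \<open>System operators and the canonical commutation relations\<close>

text \<open>A complex unital \<open>*\<close>-algebra (scalar multiplication \<open>smul\<close>, adjoint \<open>star\<close>) with elements
  \<open>a j\<close> that satisfy the canonical commutation relations.\<close>

definition commutator :: "'w::ring \<Rightarrow> 'w \<Rightarrow> 'w" where
  "commutator x y = x * y - y * x"

locale ccr_algebra = vector_space smul
  for smul :: "complex \<Rightarrow> 'w::ring_1 \<Rightarrow> 'w" +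
  fixes star :: "'w \<Rightarrow> 'w"
    and a :: "'n::finite \<Rightarrow> 'w"
  assumes scale_mult_left: "smul c x * y = smul c (x * y)"
    and scale_mult_right: "x * smul c y = smul c (x * y)"
    and star_star: "star (star x) = x"
    and star_add: "star (x + y) = star x + star y"
    and star_mult: "star (x * y) = star y * star x"
    and star_scale: "star (smul c x) = smul (cnj c) (star x)"
    and ccr: "commutator (a j) (star (a k)) = (if j = k then 1 else 0)"
    and ccr_zero: "commutator (a j) (a k) = 0"

text \<open>The components of the operator vector \<open>(a, a\<^sup>#)\<close>.\<close>

definition doubled_op :: "('w \<Rightarrow> 'w) \<Rightarrow> ('n \<Rightarrow> 'w) \<Rightarrow> 'n + 'n \<Rightarrow> 'w" where
  "doubled_op star a i = (case i of Inl k \<Rightarrow> a k | Inr k \<Rightarrow> star (a k))"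

definition coupling_op ::
  "(complex \<Rightarrow> 'w::ring_1 \<Rightarrow> 'w) \<Rightarrow> ('w \<Rightarrow> 'w) \<Rightarrow> ('n::finite \<Rightarrow> 'w) \<Rightarrow>
   ('n, 'm::finite) lqs \<Rightarrow> 'm \<Rightarrow> 'w" where
  "coupling_op smul star a Q j =
     (\<Sum>k\<in>UNIV. smul (Cminus Q $ j $ k) (a k)) + (\<Sum>k\<in>UNIV. smul (Cplus Q $ j $ k) (star (a k)))"

definition hamiltonian ::
  "(complex \<Rightarrow> 'w::ring_1 \<Rightarrow> 'w) \<Rightarrow> ('w \<Rightarrow> 'w) \<Rightarrow> ('n::finite \<Rightarrow> 'w) \<Rightarrow>
   ('n, 'm::finite) lqs \<Rightarrow> 'w" where
  "hamiltonian smul star a Q = smul (1 / 2)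
     (\<Sum>i\<in>UNIV. \<Sum>j\<in>UNIV.
        smul (Omega_mat Q $ i $ j) (star (doubled_op star a i) * doubled_op star a j))"

end

theory Submission
  imports Defs
begin

text \<open>Since \<open>\<Omega>\<^sub>-\<close> is Hermitian, \<open>\<Omega>\<^sub>+\<close> is symmetric and \<open>\<Omega>\<^sub>- = \<plusminus>\<Omega>\<^sub>+\<close>, the matrix \<open>\<Omega>\<^sub>-\<close> is real, so the
  Hamiltonian is a quadratic form in the single quadrature \<open>z\<close> (\<open>p\<close> or \<open>q\<close>) that enters \<open>L\<close>. With
  \<open>z = T x\<close>, the quadrature matrices \<open>A, B, C\<close> of the system therefore satisfy \<open>T A = 0\<close>, \<open>T B = 0\<close>
  and \<open>C = Y T\<close>. From this, \<open>C (s I - A)\<^sup>-\<^sup>1 B\<close> vanishes and the transfer matrix is the identity.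
  Because \<open>Im \<Omega>\<^sub>- = 0\<close>, observability of the given subsystem forces \<open>Y\<close> to have full column
  rank, so that \<open>C\<close> determines \<open>T\<close>.\<close>

section \<open>Block matrices\<close>

lemma sum_UNIV_sum:
  fixes f :: "'a::finite + 'b::finite \<Rightarrow> 'c::comm_monoid_add"
  shows "(\<Sum>k\<in>UNIV. f k) = (\<Sum>k\<in>UNIV. f (Inl k)) + (\<Sum>k\<in>UNIV. f (Inr k))"
  by (simp add: UNIV_Plus_UNIV [symmetric] sum.Plus del: UNIV_Plus_UNIV)

lemma block_mat_mult:
  "block_mat A B C D ** block_mat E F G H =
    block_mat (A ** E + B ** G) (A ** F + B ** H) (C ** E + D ** G) (C ** F + D ** H)"
  by (auto simp: vec_eq_iff block_mat_def matrix_matrix_mult_def sum_UNIV_sum split: sum.split)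

lemma scaleR_block_mat:
  "r *\<^sub>R block_mat A B C D = block_mat (r *\<^sub>R A) (r *\<^sub>R B) (r *\<^sub>R C) (r *\<^sub>R D)"
  by (auto simp: vec_eq_iff block_mat_def split: sum.split)

lemma uminus_block_mat: "- block_mat A B C D = block_mat (- A) (- B) (- C) (- D)"
  for A B C D :: "'a::ab_group_add^'x^'y"
  by (auto simp: vec_eq_iff block_mat_def split: sum.split)

lemma Re_block_mat:
  "Re_mat (block_mat A B C D) = block_mat (Re_mat A) (Re_mat B) (Re_mat C) (Re_mat D)"
  by (auto simp: vec_eq_iff block_mat_def split: sum.split)

lemma adj_block_mat: "adj (block_mat A B C D) = block_mat (adj A) (adj C) (adj B) (adj D)"
  by (auto simp: vec_eq_iff block_mat_def adj_def transpose_def split: sum.split)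

lemma mult_mat_nth: "(X ** mat c) $ i $ j = X $ i $ j * c"
  for X :: "'a::comm_semiring_1^'c^'r"
  by (simp add: mat_def matrix_matrix_mult_def if_distrib [of "\<lambda>x. _ * x"] cong: if_cong)

lemma block_mat_eq_iff:
  "block_mat A B C D = block_mat E F G H \<longleftrightarrow> A = E \<and> B = F \<and> C = G \<and> D = H"
  by (auto simp: vec_eq_iff block_mat_def split: sum.splits)


lemma uminus_matrix_mult: "- X ** Y = - (X ** Y)"
  for X :: "'a::ring_1^'x^'y" and Y :: "'a^'z^'x"
  by (simp add: vec_eq_iff matrix_matrix_mult_def sum_negf)

lemma matrix_mult_uminus: "X ** - Y = - (X ** Y)"
  for X :: "'a::ring_1^'x^'y" and Y :: "'a^'z^'x"
  by (simp add: vec_eq_iff matrix_matrix_mult_def sum_negf)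

lemma scaleR_matrix_mult: "(r *\<^sub>R X) ** Y = r *\<^sub>R (X ** Y)"
  for X :: "'a::real_algebra_1^'x^'y" and Y :: "'a^'z^'x"
  by (simp add: vec_eq_iff matrix_matrix_mult_def scaleR_sum_right)

lemma matrix_mult_scaleR: "X ** (r *\<^sub>R Y) = r *\<^sub>R (X ** Y)"
  for X :: "'a::real_algebra_1^'x^'y" and Y :: "'a^'z^'x"
  by (simp add: vec_eq_iff matrix_matrix_mult_def scaleR_sum_right)


section \<open>Doubled-up matrices in quadrature form\<close>

lemma adj_V_mat:
  "adj (V_mat :: complex^('k::finite + 'k)^('k + 'k)) =
    (1 / sqrt 2) *\<^sub>R block_mat (mat 1) (mat \<i>) (mat 1) (- mat \<i>)"
  by (auto simp: vec_eq_iff V_mat_def block_mat_def adj_def transpose_def mat_def split: sum.split)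

text \<open>\<open>Delta U W\<close> encodes the real-linear map z -> U z + W z^#. For z = q + i p
  its value is (U + W) q + i (U - W) p, and the real and imaginary parts of this give the four
  blocks.\<close>

lemma quadrature_Delta:
  "Re_mat (V_mat ** Delta U W ** adj V_mat) =
    block_mat (Re_mat (U + W)) (- Im_mat (U - W)) (Im_mat (U + W)) (Re_mat (U - W))"
proof -
  have "V_mat ** Delta U W ** adj V_mat =
    (1 / 2) *\<^sub>R (block_mat (mat 1) (mat 1) (- mat \<i>) (mat \<i>) ** Delta U W **
      block_mat (mat 1) (mat \<i>) (mat 1) (- mat \<i>))"
    unfolding adj_V_mat unfolding V_mat_def
    by (simp add: scaleR_matrix_mult matrix_mult_scaleR)
  then show ?thesis
    by (simp add: Delta_def block_mat_mult scaleR_block_mat Re_block_mat block_mat_eq_iff)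
      (simp add: vec_eq_iff uminus_matrix_mult matrix_mult_uminus mat_mult_nth mult_mat_nth
        algebra_simps)
qed

text \<open>Composing two maps z -> U z + W z^# gives another of the same form; the conjugates come
  from applying ^# to the inner map.\<close>

lemma Delta_mult:
  "Delta U W ** Delta U' W' =
    Delta (U ** U' + W ** conj_mat W') (U ** W' + W ** conj_mat U')"
  unfolding Delta_def block_mat_mult block_mat_eq_iff
  by (simp add: vec_eq_iff matrix_matrix_mult_def add.commute)

text \<open>The two factors \<open>J_mat\<close> cancel on the diagonal blocks and flip the sign of
  the off-diagonal ones.\<close>

lemma flat_Delta: "flat (Delta U W) = Delta (adj U) (- transpose W)"
  unfolding flat_def Delta_def J_mat_def
  by (simp add: adj_block_mat block_mat_mult block_mat_eq_iff uminus_matrix_mult matrix_mult_uminus)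
    (simp add: vec_eq_iff adj_def transpose_def)

lemma iJ_Delta: "mat (- \<i>) ** J_mat ** Delta U W = Delta (mat (- \<i>) ** U) (mat (- \<i>) ** W)"
  unfolding matrix_mul_assoc [symmetric]
  unfolding J_mat_def Delta_def block_mat_mult
  by (auto simp: vec_eq_iff mat_mult_nth uminus_matrix_mult block_mat_def split: sum.split)

lemma Delta_diff: "Delta U W - Delta U' W' = Delta (U - U') (W - W')"
  by (auto simp: vec_eq_iff Delta_def block_mat_def split: sum.split)

lemma scaleR_Delta: "r *\<^sub>R Delta U W = Delta (r *\<^sub>R U) (r *\<^sub>R W)"
  by (auto simp: vec_eq_iff Delta_def block_mat_def split: sum.split)


section \<open>Systems coupled through a single quadrature\<close>

lemma complex_mat_mult: "complex_mat (X ** Y) = complex_mat X ** complex_mat Y"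
  by (simp add: vec_eq_iff matrix_matrix_mult_def)

text \<open>From T A = 0 follows T (s I - A) = s T, hence T = s T R for the resolvent R. Multiplying
  by B gives s T R B = T B = 0, and s cancels unless it is 0, where T itself vanishes.\<close>

lemma resolvent_annihilated:
  fixes A :: "complex^'x^'x"
  assumes "T ** A = 0" "T ** B = 0" "invertible (mat s - A)"
  shows "T ** matrix_inv (mat s - A) ** B = 0"
proof -
  let ?R = "matrix_inv (mat s - A)"
  have "T ** (mat s - A) = T ** mat s - T ** A"
    by (simp add: vec_eq_iff matrix_matrix_mult_def right_diff_distrib sum_subtractf)
  then have sub: "T ** (mat s - A) = mat s ** T"
    by (simp add: assms(1) vec_eq_iff mat_mult_nth mult_mat_nth mult.commute)
  \<comment> \<open>\<open>matrix_inv\<close> is a Hilbert choice; invertibility guarantees that it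
    picks an inverse.\<close>
  have "(mat s - A) ** ?R = mat 1"
    using someI_ex [OF assms(3) [unfolded invertible_def]] by (simp add: matrix_inv_def)
  then have "T = T ** ((mat s - A) ** ?R)"
    by simp
  also have "\<dots> = mat s ** (T ** ?R)"
    by (simp only: matrix_mul_assoc sub)
  finally have T: "T = mat s ** (T ** ?R)" .
  show ?thesis
  proof (cases "s = 0")
    case True
    then have "T = 0"
      by (subst T) (simp add: vec_eq_iff mat_mult_nth)
    then show ?thesis by simp
  next
    case False
    have "mat s ** (T ** ?R ** B) = 0"
      using T assms(2) by (metis matrix_mul_assoc)
    with False show ?thesis
      by (simp add: vec_eq_iff mat_mult_nth)
  qed
qed

lemma quad_D_no_scattering: "scattering Q = mat 1 \<Longrightarrow> quad_D Q = mat 1"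
  unfolding quad_D_def quadrature_Delta
  by (auto simp: vec_eq_iff block_mat_def mat_def split: sum.split)

lemma BAE_if_factorised:
  fixes Q :: "('n::finite, 'm::finite) lqs"
  assumes "T ** quad_A Q = 0" "T ** quad_B Q = 0" "quad_C Q = Y ** T" "scattering Q = mat 1"
  shows "BAE_pin_qout Q" "BAE_qin_pout Q"
proof -
  have "transfer Q s = mat 1" if "invertible (mat s - complex_mat (quad_A Q))" for s
  proof -
    have "complex_mat T ** matrix_inv (mat s - complex_mat (quad_A Q)) ** complex_mat (quad_B Q) = 0"
      using that
      by (intro resolvent_annihilated)
        (simp_all flip: complex_mat_mult add: assms, simp_all add: vec_eq_iff)
    then have "complex_mat (quad_C Q) ** matrix_inv (mat s - complex_mat (quad_A Q)) **
        complex_mat (quad_B Q) = 0"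
      unfolding assms(3) complex_mat_mult by (simp flip: matrix_mul_assoc)
    moreover have "complex_mat (quad_D Q) = mat 1"
      by (simp add: quad_D_no_scattering assms(4) vec_eq_iff mat_def)
    ultimately show ?thesis
      by (simp add: transfer_def)
  qed
  then show "BAE_pin_qout Q" "BAE_qin_pout Q"
    by (auto simp: BAE_pin_qout_def BAE_qin_pout_def vanishes_identically_def
        transfer_pin_qout_def transfer_qin_pout_def block12_def block21_def vec_eq_iff mat_def)
qed

section \<open>Row spaces and observability\<close>

lemma rows_mult_subset_span: "rows (Z ** X) \<subseteq> span (rows X)" for X :: "real^'x^'y"
proof
  fix v assume "v \<in> rows (Z ** X)"
  then obtain i where "v = row i (Z ** X)"
    by (auto simp: rows_def)
  then have "v = (\<Sum>k\<in>UNIV. Z $ i $ k *\<^sub>R row k X)"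
    by (simp add: vec_eq_iff row_def matrix_matrix_mult_def)
  moreover have "row k X \<in> span (rows X)" for k
    by (auto simp: rows_def intro: span_base)
  ultimately show "v \<in> span (rows X)"
    by (simp add: span_sum span_scale)
qed

lemma rows_subset_observability_rows: "rows C \<subseteq> observability_rows A C"
proof -
  have "rows (C ** mat_pow A 0) \<subseteq> observability_rows A C"
    unfolding observability_rows_def by (rule UN_upper) simp
  then show ?thesis
    by (simp add: mat_pow_def)
qed

text \<open>With zero drift every block X A^k with k > 0 vanishes, so the rows of X alone must reach
  full dimension.\<close>

lemma observable_zero_span:
  assumes "observable 0 X"
  shows "span (rows X) = UNIV"
proof -
  have "v \<in> span (rows X)" if v: "v \<in> observability_rows 0 X" for v
  proof -
    obtain k where k: "v \<in> rows (X ** mat_pow 0 k)"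
      using v by (auto simp: observability_rows_def)
    show ?thesis
    proof (cases k)
      case 0
      with k show ?thesis
        by (simp add: mat_pow_def span_base)
    next
      case (Suc l)
      with k have "v = 0"
        by (auto simp: mat_pow_def rows_def row_def vec_eq_iff)
      then show ?thesis
        by (simp add: span_zero)
    qed
  qed
  then have "CARD('a) \<le> dim (rows X)"
    using assms dim_mono [of "observability_rows 0 X" "rows X"] by (auto simp: observable_def)
  then show ?thesis
    using dim_subset_UNIV [of "rows X"] dim_eq_full [of "rows X"] by simp
qed

text \<open>X is the output matrix of the subsystem assumed observable; its rows span everything,
  hence so do those of Y. A left inverse Z of Y gives Z C = Z Y T = T, so the first block of the
  observability matrix already contains T in its row space.\<close>

lemma QND_if_factorised:
  fixes Q :: "('n::finite, 'm::finite) lqs"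
  assumes "T ** quad_A Q = 0" "T ** quad_B Q = 0" "quad_C Q = Y ** T"
    and "observable 0 X" "rows X \<subseteq> span (rows Y)"
  shows "QND_variable Q T"
proof -
  have "span (rows Y) = UNIV"
    using span_mono [OF assms(5)] observable_zero_span [OF assms(4)] by (auto simp: span_span)
  then obtain Z where "Z ** Y = mat 1"
    using matrix_left_invertible_span_rows by blast
  then have "T = Z ** quad_C Q"
    by (simp add: assms(3) matrix_mul_assoc)
  then have "rows T \<subseteq> span (rows (quad_C Q))"
    using rows_mult_subset_span by metis
  also have "\<dots> \<subseteq> span (observability_rows (quad_A Q) (quad_C Q))"
    by (intro span_mono rows_subset_observability_rows)
  finally show ?thesis
    \<comment> \<open>T A = 0 means that the variable is constant, so F = 0 serves as its
      dynamics.\<close>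
    using assms(1,2) by (auto simp: QND_variable_def intro!: exI [of _ 0])
qed

section \<open>Block formulas for the quadrature matrices\<close>

lemma Omega_hermitianD:
  assumes "linear_quantum_system Q"
  shows "adj (Omegaminus Q) = Omegaminus Q" "transpose (Omegaplus Q) = Omegaplus Q"
proof -
  have "adj (Omegaminus Q) = Omegaminus Q \<and> adj (conj_mat (Omegaplus Q)) = Omegaplus Q"
    using assms
    unfolding linear_quantum_system_def Omega_mat_def Delta_def adj_block_mat block_mat_eq_iff
    by blast
  then show "adj (Omegaminus Q) = Omegaminus Q" "transpose (Omegaplus Q) = Omegaplus Q"
    by (simp_all add: adj_def vec_eq_iff transpose_def)
qed

lemma Im_eq_zero_if_hermitian_symmetric:
  assumes "adj X = X" "transpose X = X"
  shows "Im_mat X = 0"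
proof -
  have "cnj (X $ i $ j) = X $ i $ j" for i j
    using assms by (simp add: vec_eq_iff adj_def transpose_def)
  then show ?thesis
    by (simp add: vec_eq_iff complex_eq_iff)
qed

lemma quad_B_no_scattering:
  assumes "scattering Q = mat 1"
  shows "quad_B Q = - block_mat
    (Re_mat (adj (Cminus Q) - transpose (Cplus Q))) (- Im_mat (adj (Cminus Q) + transpose (Cplus Q)))
    (Im_mat (adj (Cminus Q) - transpose (Cplus Q))) (Re_mat (adj (Cminus Q) + transpose (Cplus Q)))"
proof -
  have [simp]: "Delta (mat 1) 0 = mat 1"
    by (auto simp: vec_eq_iff Delta_def block_mat_def mat_def split: sum.split)
  have [simp]: "Re_mat (- X) = - Re_mat X" for X :: "complex^'x^'y"
    by (simp add: vec_eq_iff)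
  show ?thesis
    unfolding quad_B_def coupling_mat_def assms
    by (simp add: flat_Delta quadrature_Delta)
qed

lemma quad_A_Delta:
  fixes Q :: "('n::finite, 'm::finite) lqs"
  defines "U \<equiv> mat (- \<i>) ** Omegaminus Q -
      (1 / 2) *\<^sub>R (adj (Cminus Q) ** Cminus Q - transpose (Cplus Q) ** conj_mat (Cplus Q))"
    and "W \<equiv> mat (- \<i>) ** Omegaplus Q -
      (1 / 2) *\<^sub>R (adj (Cminus Q) ** Cplus Q - transpose (Cplus Q) ** conj_mat (Cminus Q))"
  shows "quad_A Q = block_mat (Re_mat (U + W)) (- Im_mat (U - W)) (Im_mat (U + W)) (Re_mat (U - W))"
  unfolding quad_A_def coupling_mat_def Omega_mat_def flat_Delta iJ_Delta Delta_mult scaleR_Delta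
    Delta_diff quadrature_Delta U_def W_def uminus_matrix_mult by simp

lemma quad_C_blocks:
  "quad_C Q = block_mat
    (Re_mat (Cminus Q + Cplus Q)) (- Im_mat (Cminus Q - Cplus Q))
    (Im_mat (Cminus Q + Cplus Q)) (Re_mat (Cminus Q - Cplus Q))"
  unfolding quad_C_def coupling_mat_def by (rule quadrature_Delta)

text \<open>The two products are entrywise conjugates of each other, so their difference is purely
  imaginary, and so is -i W for real W.\<close>

lemma Re_drift_zero:
  assumes "Im_mat W = 0"
  shows "Re_mat (mat (- \<i>) ** W - (1 / 2) *\<^sub>R (adj C ** C - transpose C ** conj_mat C)) = 0"
proof -
  have "(transpose C ** conj_mat C) $ i $ j = cnj ((adj C ** C) $ i $ j)" for i j
    by (simp add: adj_def transpose_def matrix_matrix_mult_def)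
  with assms show ?thesis
    by (simp add: vec_eq_iff mat_mult_nth)
qed

section \<open>Selecting one quadrature\<close>

lemma p_select_mult_block_mat:
  "p_select ** block_mat A B C D = (\<chi> i j. case j of Inl l \<Rightarrow> C $ i $ l | Inr l \<Rightarrow> D $ i $ l)"
  for A B :: "real^'x::finite^'n" and C D :: "real^'x^'n"
  by (simp add: vec_eq_iff matrix_matrix_mult_def p_select_def block_mat_def
      if_distrib [of "\<lambda>x. x * _"] cong: if_cong)

lemma q_select_mult_block_mat:
  "q_select ** block_mat A B C D = (\<chi> i j. case j of Inl l \<Rightarrow> A $ i $ l | Inr l \<Rightarrow> B $ i $ l)"
  by (simp add: vec_eq_iff matrix_matrix_mult_def q_select_def block_mat_def
      if_distrib [of "\<lambda>x. x * _"] cong: if_cong)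

lemma mult_p_select: "Y ** p_select = (\<chi> i j. case j of Inl l \<Rightarrow> 0 | Inr l \<Rightarrow> Y $ i $ l)"
  by (auto simp: vec_eq_iff matrix_matrix_mult_def p_select_def if_distrib [of "\<lambda>x. _ * x"]
      cong: if_cong split: sum.split)

lemma mult_q_select: "Y ** q_select = (\<chi> i j. case j of Inl l \<Rightarrow> Y $ i $ l | Inr l \<Rightarrow> 0)"
  by (auto simp: vec_eq_iff matrix_matrix_mult_def q_select_def if_distrib [of "\<lambda>x. _ * x"]
      cong: if_cong split: sum.split)

text \<open>The sum of \<open>Cminus\<close> and \<open>Cplus\<close> is 0 and their difference is
  twice \<open>Cminus\<close>, so the left blocks of \<open>quad_C\<close> vanish and its right
  blocks form Y. In the p-rows of B, a matrix plus its conjugate has no imaginary part and a matrix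
  minus its conjugate has no real part.\<close>

lemma p_coupling_factorised:
  fixes Q :: "('n::finite, 'm::finite) lqs"
  assumes "linear_quantum_system Q" "scattering Q = mat 1"
    and "Cminus Q = - Cplus Q" "Omegaminus Q = - Omegaplus Q"
  defines "Y \<equiv> \<chi> i. case i of
      Inl k \<Rightarrow> - 2 *\<^sub>R Im_mat (Cminus Q) $ k | Inr k \<Rightarrow> 2 *\<^sub>R Re_mat (Cminus Q) $ k"
  shows "Im_mat (Omegaminus Q) = 0" "p_select ** quad_A Q = 0" "p_select ** quad_B Q = 0"
    "quad_C Q = Y ** p_select"
proof -
  have C: "Cplus Q = - Cminus Q" and \<Omega>: "Omegaplus Q = - Omegaminus Q"
    using assms by simp_all
  show Im: "Im_mat (Omegaminus Q) = 0"
    using Omega_hermitianD [OF assms(1)] \<Omega>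
    by (intro Im_eq_zero_if_hermitian_symmetric) (auto simp: vec_eq_iff transpose_def)
  have conj: "conj_mat (- X) = - conj_mat X" for X :: "complex^'x^'y"
    by (simp add: vec_eq_iff)
  have transp: "transpose (- X) = - transpose X" for X :: "complex^'x^'y"
    by (simp add: vec_eq_iff transpose_def)
  define U where "U = mat (- \<i>) ** Omegaminus Q -
      (1 / 2) *\<^sub>R (adj (Cminus Q) ** Cminus Q - transpose (Cminus Q) ** conj_mat (Cminus Q))"
  \<comment> \<open>Both sign changes turn the second argument of the doubled-up drift into -U, so
    the p-rows of A are Im (U + W) = 0 and Re (U - W) = 2 Re U.\<close>
  define W where "W = - U"
  have "quad_A Q =
      block_mat (Re_mat (U + W)) (- Im_mat (U - W)) (Im_mat (U + W)) (Re_mat (U - W))"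
    unfolding quad_A_Delta C \<Omega> U_def W_def
    by (simp add: conj transp uminus_matrix_mult matrix_mult_uminus algebra_simps)
  moreover have "Re_mat U = 0"
    unfolding U_def by (rule Re_drift_zero [OF Im])
  then have "Re (U $ i $ j) = 0" "Re (W $ i $ j) = 0" "Im (W $ i $ j) = - Im (U $ i $ j)" for i j
    by (simp_all add: W_def vec_eq_iff)
  ultimately show "p_select ** quad_A Q = 0"
    by (simp only: p_select_mult_block_mat) (simp add: vec_eq_iff split: sum.split)
  show "p_select ** quad_B Q = 0"
    unfolding quad_B_no_scattering [OF assms(2)] C uminus_block_mat
    by (auto simp: p_select_mult_block_mat vec_eq_iff adj_def transpose_def split: sum.split)
  show "quad_C Q = Y ** p_select"
    unfolding quad_C_blocks C
    by (auto simp: mult_p_select Y_def block_mat_def vec_eq_iff split: sum.split)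
qed

text \<open>Mirror image of the p-case: now the differences vanish, so \<open>quad_C\<close> keeps
  only its left blocks.\<close>

lemma q_coupling_factorised:
  fixes Q :: "('n::finite, 'm::finite) lqs"
  assumes "linear_quantum_system Q" "scattering Q = mat 1"
    and "Cminus Q = Cplus Q" "Omegaminus Q = Omegaplus Q"
  defines "Y \<equiv> \<chi> i. case i of
      Inl k \<Rightarrow> 2 *\<^sub>R Re_mat (Cminus Q) $ k | Inr k \<Rightarrow> 2 *\<^sub>R Im_mat (Cminus Q) $ k"
  shows "Im_mat (Omegaminus Q) = 0" "q_select ** quad_A Q = 0" "q_select ** quad_B Q = 0"
    "quad_C Q = Y ** q_select"
proof -
  have C: "Cplus Q = Cminus Q" and \<Omega>: "Omegaplus Q = Omegaminus Q"
    using assms by simp_all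
  show Im: "Im_mat (Omegaminus Q) = 0"
    using Omega_hermitianD [OF assms(1)] \<Omega>
    by (intro Im_eq_zero_if_hermitian_symmetric) (auto simp: vec_eq_iff transpose_def)
  define U where "U = mat (- \<i>) ** Omegaminus Q -
      (1 / 2) *\<^sub>R (adj (Cminus Q) ** Cminus Q - transpose (Cminus Q) ** conj_mat (Cminus Q))"
  \<comment> \<open>Both arguments of the doubled-up drift now equal U, so the q-rows of A are 2 Re
    U and 0.\<close>
  have "quad_A Q =
      block_mat (Re_mat (U + U)) (- Im_mat (U - U)) (Im_mat (U + U)) (Re_mat (U - U))"
    unfolding quad_A_Delta C \<Omega> U_def ..
  moreover have "Re_mat U = 0"
    unfolding U_def by (rule Re_drift_zero [OF Im])
  then have "Re (U $ i $ j) = 0" for i j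
    by (simp add: vec_eq_iff)
  ultimately show "q_select ** quad_A Q = 0"
    by (simp only: q_select_mult_block_mat) (simp add: vec_eq_iff split: sum.split)
  show "q_select ** quad_B Q = 0"
    unfolding quad_B_no_scattering [OF assms(2)] C uminus_block_mat
    by (auto simp: q_select_mult_block_mat vec_eq_iff adj_def transpose_def split: sum.split)
  show "quad_C Q = Y ** q_select"
    unfolding quad_C_blocks C
    by (auto simp: mult_q_select Y_def block_mat_def vec_eq_iff split: sum.split)
qed

text \<open>Serves to find the subsystem's output matrix inside Y, whose halves carry factors 2 or
  -2.\<close>

lemma rows_subset_span_rows_scaled:
  fixes X :: "real^'x^'z" and Y :: "real^'x^'y"
  assumes "\<And>k. \<exists>i c. row k X = c *\<^sub>R row i Y"
  shows "rows X \<subseteq> span (rows Y)"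
proof
  fix v assume "v \<in> rows X"
  then obtain i c where "v = c *\<^sub>R row i Y"
    using assms by (fastforce simp: rows_def)
  moreover have "row i Y \<in> span (rows Y)"
    by (auto simp: rows_def intro: span_base)
  ultimately show "v \<in> span (rows Y)"
    by (simp add: span_scale)
qed

theorem theorem5:
  fixes Q :: "('n::finite, 'm::finite) lqs"
    and smul :: "complex \<Rightarrow> 'w::ring_1 \<Rightarrow> 'w"
    and star :: "'w \<Rightarrow> 'w"
    and a :: "'n \<Rightarrow> 'w"
  assumes system: "linear_quantum_system Q"
    and no_scattering: "scattering Q = mat 1"
    and operators: "ccr_algebra smul star a"
    and commute: "\<forall>j. commutator (coupling_op smul star a Q j) (hamiltonian smul star a Q) = 0"
  shows
    "(Cminus Q = - Cplus Q \<and> Omegaminus Q = - Omegaplus Q \<longrightarrow>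
        (observable (Im_mat (Omegaminus Q)) (- Im_mat (Cminus Q)) \<or>
         observable (Im_mat (Omegaminus Q)) (Re_mat (Cminus Q)) \<longrightarrow>
         QND_variable Q p_select) \<and>
        BAE_pin_qout Q \<and> BAE_qin_pout Q) \<and>
     (Cminus Q = Cplus Q \<and> Omegaminus Q = Omegaplus Q \<longrightarrow>
        (observable (Im_mat (Omegaminus Q)) (Im_mat (Cminus Q)) \<or>
         observable (Im_mat (Omegaminus Q)) (Re_mat (Cminus Q)) \<longrightarrow>
         QND_variable Q q_select) \<and>
        BAE_pin_qout Q \<and> BAE_qin_pout Q)"
proof -
  have factor: "BAE_pin_qout Q \<and> BAE_qin_pout Q"
      "observable 0 X \<Longrightarrow> rows X \<subseteq> span (rows Y) \<Longrightarrow> QND_variable Q T"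
    if "T ** quad_A Q = 0" "T ** quad_B Q = 0" "quad_C Q = Y ** T"
    for T :: "real^('n + 'n)^'n" and Y and X :: "real^'n^'m"
    using that BAE_if_factorised [OF that no_scattering] QND_if_factorised [OF that] by auto
  have "(observable (Im_mat (Omegaminus Q)) (- Im_mat (Cminus Q)) \<or>
         observable (Im_mat (Omegaminus Q)) (Re_mat (Cminus Q)) \<longrightarrow> QND_variable Q p_select) \<and>
        BAE_pin_qout Q \<and> BAE_qin_pout Q"
    if "Cminus Q = - Cplus Q" "Omegaminus Q = - Omegaplus Q"
  proof -
    note p = p_coupling_factorised [OF system no_scattering that]
    define Y :: "real^'n^('m + 'm)" where "Y = (\<chi> i. case i of
        Inl k \<Rightarrow> - 2 *\<^sub>R Im_mat (Cminus Q) $ k | Inr k \<Rightarrow> 2 *\<^sub>R Re_mat (Cminus Q) $ k)"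
    have "rows (- Im_mat (Cminus Q)) \<subseteq> span (rows Y)"
    proof (rule rows_subset_span_rows_scaled)
      show "\<exists>i c. row k (- Im_mat (Cminus Q)) = c *\<^sub>R row i Y" for k
        \<comment> \<open>The upper half of Y holds -2 Im of \<open>Cminus\<close>; the lower half,
          used for the other alternative, holds 2 Re of it.\<close>
        by (intro exI [of _ "Inl k"] exI [of _ "1 / 2"]) (simp add: Y_def row_def vec_eq_iff)
    qed
    moreover have "rows (Re_mat (Cminus Q)) \<subseteq> span (rows Y)"
    proof (rule rows_subset_span_rows_scaled)
      show "\<exists>i c. row k (Re_mat (Cminus Q)) = c *\<^sub>R row i Y" for k
        by (intro exI [of _ "Inr k"] exI [of _ "1 / 2"]) (simp add: Y_def row_def vec_eq_iff)
    qed
    ultimately show ?thesis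
      \<comment> \<open>\<open>p(1)\<close> turns the drift of the subsystem into 0, the form that
        \<open>factor\<close> expects.\<close>
      using factor [OF p(2-4) [folded Y_def]] p(1) by auto
  qed
  moreover have "(observable (Im_mat (Omegaminus Q)) (Im_mat (Cminus Q)) \<or>
         observable (Im_mat (Omegaminus Q)) (Re_mat (Cminus Q)) \<longrightarrow> QND_variable Q q_select) \<and>
        BAE_pin_qout Q \<and> BAE_qin_pout Q"
    if "Cminus Q = Cplus Q" "Omegaminus Q = Omegaplus Q"
  proof -
    note q = q_coupling_factorised [OF system no_scattering that]
    define Y :: "real^'n^('m + 'm)" where "Y = (\<chi> i. case i of
        Inl k \<Rightarrow> 2 *\<^sub>R Re_mat (Cminus Q) $ k | Inr k \<Rightarrow> 2 *\<^sub>R Im_mat (Cminus Q) $ k)"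
    have "rows (Im_mat (Cminus Q)) \<subseteq> span (rows Y)"
    proof (rule rows_subset_span_rows_scaled)
      show "\<exists>i c. row k (Im_mat (Cminus Q)) = c *\<^sub>R row i Y" for k
        \<comment> \<open>Here the halves are exchanged: the imaginary part sits in the lower half
          of Y, the real part in the upper.\<close>
        by (intro exI [of _ "Inr k"] exI [of _ "1 / 2"]) (simp add: Y_def row_def vec_eq_iff)
    qed
    moreover have "rows (Re_mat (Cminus Q)) \<subseteq> span (rows Y)"
    proof (rule rows_subset_span_rows_scaled)
      show "\<exists>i c. row k (Re_mat (Cminus Q)) = c *\<^sub>R row i Y" for k
        by (intro exI [of _ "Inl k"] exI [of _ "1 / 2"]) (simp add: Y_def row_def vec_eq_iff)
    qed
    ultimately show ?thesis
      using factor [OF q(2-4) [folded Y_def]] q(1) by auto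
  qed
  ultimately show ?thesis
    by blast
qed

end
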